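(* Let $(X,\pi,\leq)$ be the Priestley space of a bounded distributive lattice $L$. Let $\mathcal{C}$ be the set of convex closed subsets of $X$ with the Egli-Milner order and the weak hit-or-miss topology. Then $\mathcal{C}$ is order-homeomorphic to $\mathcal{F}^{\Diamond\Box}/{\sim}$, and hence is a Priestley space.
   Context: A Priestley space is a compact space with a partial order $\le$ such that if $x\nleq y$ then there is a clopen upset containing $x$ and missing $y$. The Priestley space of $L$ consists of the set $X$ of (proper) prime filters of $L$ ordered by inclusion, with the topology $\pi$ generated by the sets $a^+=\{x\in X\mid a\in x\}$ and $a^-=\{x\in X\mid a\notin x\}$, $a\in L$. $\mathcal{F}$ is the set of all closed subsets of $(X,\pi)$ (including $\varnothing$). For $U$ open and $K$ compact in $(X,\pi)$ let $\Diamond_U=\{C\in\mathcal{F}\mid C\cap U\neq\varnothing\}$ and $\Box_K=\{C\in\mathcal{F}\mid C\cap K=\varnothing\}$. $\mathcal{F}^{\Diamond\Box}$ is $\mathcal{F}$ with the hit-or-miss topology, generated by all $\Diamond_U$ and $\Box_K$. The Egli-Milner order is $A\sqsubseteq B$ iff $A\subseteq{\downarrow}B$ and $B\subseteq{\uparrow}A$; it is a quasi-order on $\mathcal{F}$. Put $A\sim B$ iff $A\sqsubseteq B$ and $B\sqsubseteq A$. $\mathcal{F}^{\Diamond\Box}/{\sim}$ is the quotient set $\mathcal{F}/{\sim}$ with the quotient topology from $\mathcal{F}^{\Diamond\Box}$ and the partial order induced by $\sqsubseteq$. A set $C\subseteq X$ is convex if $x,y\in C$ and $x\le z\le y$ imply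 $z\in C$. The restriction of $\sqsubseteq$ to convex sets is a partial order. The weak hit-or-miss topology on $\mathcal{C}$ is generated by the restrictions to $\mathcal{C}$ of the sets $\Box_{a^+},\Box_{a^-},\Diamond_{a^+},\Diamond_{a^-}$ for $a\in L$. An order-homeomorphism is a homeomorphism that is an order-isomorphism. *)

theory Defs
  imports "HOL-Analysis.Analysis"
begin

text \<open>An ordered space is a topology \<open>T\<close> together with a relation \<open>r\<close> on its underlying set
  \<open>topspace T\<close>; \<open>x \<le> y\<close> is \<open>(x, y) \<in> r\<close>.  Hence \<open>r `` B\<close> is the up-closure and
  \<open>r\<inverse> `` B\<close> the down-closure of \<open>B\<close>.\<close>

definition upset :: "'p rel \<Rightarrow> 'p set \<Rightarrow> bool" where
  "upset r U \<longleftrightarrow> (\<forall>x y. x \<in> U \<and> (x, y) \<in> r \<longrightarrow> y \<in> U)"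

text \<open>\<^const>\<open>partial_order_on\<close> includes \<open>r \<subseteq> topspace T \<times> topspace T\<close>.\<close>

definition Priestley_space :: "'p topology \<Rightarrow> 'p rel \<Rightarrow> bool" where
  "Priestley_space T r \<longleftrightarrow>
     compact_space T \<and> partial_order_on (topspace T) r \<and>
     (\<forall>x \<in> topspace T. \<forall>y \<in> topspace T. (x, y) \<notin> r \<longrightarrow>
        (\<exists>U. openin T U \<and> closedin T U \<and> upset r U \<and> x \<in> U \<and> y \<notin> U))"

definition order_homeomorphic ::
    "'p topology \<Rightarrow> 'p rel \<Rightarrow> 'q topology \<Rightarrow> 'q rel \<Rightarrow> bool" where
  "order_homeomorphic T r T' r' \<longleftrightarrow>
     (\<exists>f. homeomorphic_map T T' f \<and>
          (\<forall>x \<in> topspace T. \<forall>y \<in> topspace T. (x, y) \<in> r \<longleftrightarrow> (f x, f y) \<in> r'))"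

text \<open>The lattice is the universe of a type of sort \<open>{distrib_lattice, bounded_lattice}\<close>.
  The case \<open>bot = top\<close> is allowed; there are then no prime filters.\<close>

definition prime_filter :: "'a::{distrib_lattice,bounded_lattice} set \<Rightarrow> bool" where
  "prime_filter F \<longleftrightarrow>
     top \<in> F \<and> bot \<notin> F \<and>
     (\<forall>a b. a \<in> F \<and> a \<le> b \<longrightarrow> b \<in> F) \<and>
     (\<forall>a b. a \<in> F \<and> b \<in> F \<longrightarrow> inf a b \<in> F) \<and>
     (\<forall>a b. sup a b \<in> F \<longrightarrow> a \<in> F \<or> b \<in> F)"

definition pos_set :: "'a::{distrib_lattice,bounded_lattice} \<Rightarrow> 'a set set" where
  "pos_set a = {x. prime_filter x \<and> a \<in> x}"

definition neg_set :: "'a::{distrib_lattice,bounded_lattice} \<Rightarrow> 'a set set" where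
  "neg_set a = {x. prime_filter x \<and> a \<notin> x}"

definition priestley_topology :: "'a::{distrib_lattice,bounded_lattice} set topology" where
  "priestley_topology = topology_generated_by (range pos_set \<union> range neg_set)"

definition priestley_order :: "'a::{distrib_lattice,bounded_lattice} set rel" where
  "priestley_order = {(x, y). prime_filter x \<and> prime_filter y \<and> x \<subseteq> y}"

lemma topspace_priestley_topology [simp]:
  "topspace priestley_topology = {x. prime_filter x}"
  by (auto simp: priestley_topology_def topology_generated_by_topspace pos_set_def neg_set_def)

definition closed_sets :: "'p topology \<Rightarrow> 'p set set" where
  "closed_sets T = {C. closedin T C}"

definition hit :: "'p topology \<Rightarrow> 'p set \<Rightarrow> 'p set set" where
  "hit T U = {C \<in> closed_sets T. C \<inter> U \<noteq> {}}"

definition miss :: "'p topology \<Rightarrow> 'p set \<Rightarrow> 'p set set" where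
  "miss T K = {C \<in> closed_sets T. C \<inter> K = {}}"

definition hit_or_miss_topology :: "'p topology \<Rightarrow> 'p set topology" where
  "hit_or_miss_topology T =
     topology_generated_by ({hit T U | U. openin T U} \<union> {miss T K | K. compactin T K})"

lemma topspace_hit_or_miss_topology [simp]:
  "topspace (hit_or_miss_topology T) = closed_sets T"
proof -
  have "closed_sets T \<in> {miss T K | K. compactin T K}"
    by (auto simp: miss_def intro!: exI[of _ "{}"])
  moreover have "S \<subseteq> closed_sets T"
    if "S \<in> {hit T U | U. openin T U} \<union> {miss T K | K. compactin T K}" for S
    using that by (auto simp: hit_def miss_def)
  ultimately show ?thesis
    unfolding hit_or_miss_topology_def topology_generated_by_topspace by blast
qed

definition egli_milner :: "'p rel \<Rightarrow> 'p set set \<Rightarrow> 'p set rel" where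
  "egli_milner r \<A> =
     {(A, B). A \<in> \<A> \<and> B \<in> \<A> \<and> A \<subseteq> r\<inverse> `` B \<and> B \<subseteq> r `` A}"

lemma preorder_on_egli_milner:
  assumes "partial_order_on (topspace T) r"
  shows "preorder_on (closed_sets T) (egli_milner r (closed_sets T))"
proof -
  have r: "refl_on (topspace T) r" "trans r"
    using assms by (auto simp: partial_order_on_def preorder_on_def)
  have "A \<subseteq> r\<inverse> `` A" "A \<subseteq> r `` A" if "A \<in> closed_sets T" for A
    using that r(1) closedin_subset[of T A]
    by (auto simp: closed_sets_def refl_on_def)
  then have "refl_on (closed_sets T) (egli_milner r (closed_sets T))"
    by (auto simp: refl_on_def egli_milner_def)
  moreover have "trans (egli_milner r (closed_sets T))"
  proof (rule transI)
    fix A B C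
    assume "(A, B) \<in> egli_milner r (closed_sets T)" "(B, C) \<in> egli_milner r (closed_sets T)"
    then have *: "A \<in> closed_sets T" "C \<in> closed_sets T"
        "A \<subseteq> r\<inverse> `` B" "B \<subseteq> r\<inverse> `` C" "B \<subseteq> r `` A" "C \<subseteq> r `` B"
      by (auto simp: egli_milner_def)
    have "A \<subseteq> r\<inverse> `` (r\<inverse> `` C)" "C \<subseteq> r `` (r `` A)"
      using *(3-6) by (meson Image_mono order_refl order_trans)+
    moreover have "r\<inverse> `` (r\<inverse> `` C) \<subseteq> r\<inverse> `` C" "r `` (r `` A) \<subseteq> r `` A"
      using r(2) by (auto dest: transD)
    ultimately have "A \<subseteq> r\<inverse> `` C" "C \<subseteq> r `` A"
      by (metis order_trans)+
    then show "(A, C) \<in> egli_milner r (closed_sets T)"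
      using *(1,2) by (simp add: egli_milner_def)
  qed
  ultimately show ?thesis
    by (auto simp: preorder_on_def egli_milner_def)
qed

definition order_equiv :: "'p rel \<Rightarrow> 'p rel" where
  "order_equiv q = q \<inter> q\<inverse>"

lemma equiv_order_equiv:
  assumes "preorder_on A q"
  shows "equiv A (order_equiv q)"
  using assms
  unfolding equiv_def preorder_on_def order_equiv_def refl_on_def sym_def trans_def by blast

definition quotient_order :: "'p set \<Rightarrow> 'p rel \<Rightarrow> 'p set rel" where
  "quotient_order A q =
     {(P, Q). P \<in> A // order_equiv q \<and> Q \<in> A // order_equiv q \<and>
        (\<exists>x \<in> P. \<exists>y \<in> Q. (x, y) \<in> q)}"

definition quotient_topology :: "'p topology \<Rightarrow> 'p rel \<Rightarrow> 'p set topology" where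
  "quotient_topology T e =
     topology (\<lambda>\<U>. \<U> \<subseteq> topspace T // e \<and> openin T {x \<in> topspace T. e `` {x} \<in> \<U>})"

lemma openin_quotient_topology:
  "openin (quotient_topology T e) \<U> \<longleftrightarrow>
     \<U> \<subseteq> topspace T // e \<and> openin T {x \<in> topspace T. e `` {x} \<in> \<U>}"
proof -
  have "istopology (\<lambda>\<U>. \<U> \<subseteq> topspace T // e \<and> openin T {x \<in> topspace T. e `` {x} \<in> \<U>})"
    unfolding istopology_def
  proof (intro conjI allI impI, goal_cases)
    case (2 S S')
    have "{x \<in> topspace T. e `` {x} \<in> S \<inter> S'} =
        {x \<in> topspace T. e `` {x} \<in> S} \<inter> {x \<in> topspace T. e `` {x} \<in> S'}" by auto
    with 2 show ?case by auto
  next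
    case (4 \<K>)
    have "{x \<in> topspace T. e `` {x} \<in> \<Union>\<K>} = (\<Union>S\<in>\<K>. {x \<in> topspace T. e `` {x} \<in> S})" by auto
    moreover have "openin T (\<Union>S\<in>\<K>. {x \<in> topspace T. e `` {x} \<in> S})" using 4 by blast
    ultimately show ?case by simp
  qed auto
  then show ?thesis
    by (simp add: quotient_topology_def)
qed

lemma topspace_quotient_topology [simp]:
  "topspace (quotient_topology T e) = topspace T // e"
proof -
  have "{x \<in> topspace T. e `` {x} \<in> topspace T // e} = topspace T"
    by (auto intro: quotientI)
  then have "openin (quotient_topology T e) (topspace T // e)"
    by (simp add: openin_quotient_topology)
  then show ?thesis
    by (meson openin_quotient_topology openin_subset openin_topspace subset_antisym)
qed

lemma quotient_map_quotient_topology: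
  "quotient_map T (quotient_topology T e) (\<lambda>x. e `` {x})"
  unfolding quotient_map_def
  by (auto simp: openin_quotient_topology quotient_def)

definition order_convex :: "'p rel \<Rightarrow> 'p set \<Rightarrow> bool" where
  "order_convex r C \<longleftrightarrow>
     (\<forall>x y z. x \<in> C \<and> y \<in> C \<and> (x, z) \<in> r \<and> (z, y) \<in> r \<longrightarrow> z \<in> C)"

definition convex_closed_sets :: "'p topology \<Rightarrow> 'p rel \<Rightarrow> 'p set set" where
  "convex_closed_sets T r = {C \<in> closed_sets T. order_convex r C}"

definition weak_hit_or_miss_topology ::
    "'a::{distrib_lattice,bounded_lattice} set set topology" where
  "weak_hit_or_miss_topology =
     topology_generated_by
       {S \<inter> convex_closed_sets priestley_topology priestley_order | S a.
          S \<in> {miss priestley_topology (pos_set a), miss priestley_topology (neg_set a),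
                hit priestley_topology (pos_set a), hit priestley_topology (neg_set a)}}"

lemma topspace_weak_hit_or_miss_topology [simp]:
  "topspace weak_hit_or_miss_topology =
     (convex_closed_sets priestley_topology priestley_order ::
        'a::{distrib_lattice,bounded_lattice} set set set)"
proof -
  let ?C = "convex_closed_sets priestley_topology priestley_order :: 'a set set set"
  have "pos_set (bot::'a) = {}"
    by (auto simp: pos_set_def prime_filter_def)
  then have "?C = miss priestley_topology (pos_set bot) \<inter> ?C"
    by (auto simp: miss_def convex_closed_sets_def)
  then have "?C \<in> {S \<inter> ?C | S a.
      S \<in> {miss priestley_topology (pos_set a), miss priestley_topology (neg_set a),
            hit priestley_topology (pos_set a), hit priestley_topology (neg_set a)}}"
    by (intro CollectI exI[of _ "miss priestley_topology (pos_set bot)"] exI[of _ bot]) simp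
  then show ?thesis
    unfolding weak_hit_or_miss_topology_def topology_generated_by_topspace
    by (intro equalityI Union_least Union_upper) auto
qed

end

theory Submission
  imports Defs
begin

text \<open>The convex hull map \<open>F \<mapsto> \<up>F \<inter> \<down>F\<close> picks the unique convex set in each \<open>\<sim>\<close>-class.
  It is continuous for the weak hit-or-miss topology, because a clopen upset or downset is hit by
  \<open>F\<close> iff it is hit by the hull of \<open>F\<close>.  The hyperspace of closed sets is compact and the weak
  hit-or-miss topology is Hausdorff, so the hull map is a quotient map; its fibres are the
  \<open>\<sim>\<close>-classes.\<close>

section \<open>Compactness of hyperspaces\<close>

text \<open>Transfers Alexander's theorem to the inductively generated topology, by identifying it
  with the arbitrary unions of finite intersections relative to \<open>\<Union>\<B>\<close>. Only
  covers by subbasic sets then have to be examined.\<close>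

lemma Alexander_subbase_generated_by:
  assumes fin: "\<And>\<C>. \<lbrakk>\<C> \<subseteq> \<B>; \<Union>\<C> = \<Union>\<B>\<rbrakk> \<Longrightarrow> \<exists>\<C>'. finite \<C>' \<and> \<C>' \<subseteq> \<C> \<and> \<Union>\<C>' = \<Union>\<B>"
  shows "compact_space (topology_generated_by \<B>)"
proof (rule Alexander_subbase)
  let ?X = "topology (arbitrary union_of (finite intersection_of (\<lambda>x. x \<in> \<B>) relative_to \<Union>\<B>))"
  have "openin ?X S" if "generate_topology_on \<B> S" for S
    using that
  proof (induction rule: generate_topology_on.induct)
    case (Basis S)
    then have "S = \<Union>\<B> \<inter> S" by blast
    then have "(finite intersection_of (\<lambda>x. x \<in> \<B>) relative_to \<Union>\<B>) S"
      using Basis by (metis finite_intersection_of_inc relative_to_inc)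
    then show ?case
      by (simp add: istopology_subbase topology_inverse' arbitrary_union_of_inc)
  qed auto
  moreover have "openin (topology_generated_by \<B>) S" if "openin ?X S" for S
    using _ _ that
    by (rule minimal_topology_subbase)
      (auto simp: topology_generated_by_Basis simp flip: topology_generated_by_topspace)
  ultimately show "?X = topology_generated_by \<B>"
    by (auto simp: topology_eq openin_topology_generated_by_iff)
  show "\<exists>\<C>'. finite \<C>' \<and> \<C>' \<subseteq> \<C> \<and> \<Union>\<C>' = topspace (topology_generated_by \<B>)"
    if "\<C> \<subseteq> \<B>" "\<Union>\<C> = topspace (topology_generated_by \<B>)" for \<C>
    using fin that by simp
qed

text \<open>One closed set, chosen to escape all hit sets of a subbasic cover, must lie in some
  \<open>miss T K\<close> of the cover. Compactness of that \<open>K\<close> then yields finitely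
  many hit sets that cover the rest.\<close>

lemma compact_space_hit_or_miss_topology: "compact_space (hit_or_miss_topology T)"
  unfolding hit_or_miss_topology_def
proof (rule Alexander_subbase_generated_by)
  let ?B = "{hit T U | U. openin T U} \<union> {miss T K | K. compactin T K}"
  fix \<C> assume \<C>: "\<C> \<subseteq> ?B" "\<Union>\<C> = \<Union>?B"
  have UB: "\<Union>?B = closed_sets T"
    using topspace_hit_or_miss_topology[of T]
    by (simp add: hit_or_miss_topology_def topology_generated_by_topspace)
  define \<U> where "\<U> = {U. openin T U \<and> hit T U \<in> \<C>}"
  \<comment> \<open>\<open>D\<close> is the largest closed set lying in no hit set of the
    cover.\<close>
  define D where "D = topspace T - \<Union>\<U>"
  have "D \<in> closed_sets T"
    by (auto simp: D_def closed_sets_def \<U>_def)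
  then have "D \<in> \<Union>\<C>"
    using \<C>(2) UB by simp
  then obtain S where S: "S \<in> \<C>" "D \<in> S" ..
  have "S \<noteq> hit T U" if "openin T U" for U
    using that S by (auto simp: hit_def D_def \<U>_def)
  moreover have "S \<in> ?B"
    using S(1) \<C>(1) ..
  ultimately obtain K where K: "S = miss T K" "compactin T K"
    by blast
  have "K \<subseteq> \<Union>\<U>"
    using K(1) S(2) compactin_subset_topspace[OF K(2)] by (auto simp: miss_def D_def)
  then obtain \<V> where \<V>: "finite \<V>" "\<V> \<subseteq> \<U>" "K \<subseteq> \<Union>\<V>"
    using compactinD[OF K(2), of \<U>] by (auto simp: \<U>_def)
  have sub: "insert S (hit T ` \<V>) \<subseteq> \<C>"
    using \<V> S by (auto simp: \<U>_def)
  \<comment> \<open>A closed set either misses \<open>K\<close> or meets it, and then meets some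
    member of \<open>\<V>\<close>.\<close>
  have "closed_sets T \<subseteq> \<Union>(insert S (hit T ` \<V>))"
    using \<V>(3) by (auto simp: K(1) miss_def hit_def)
  moreover have "\<Union>(insert S (hit T ` \<V>)) \<subseteq> \<Union>\<C>"
    using sub by (rule Union_mono)
  ultimately have "\<Union>(insert S (hit T ` \<V>)) = \<Union>?B"
    unfolding \<C>(2) UB by (intro equalityI)
  with sub \<V>(1) show "\<exists>\<C>'. finite \<C>' \<and> \<C>' \<subseteq> \<C> \<and> \<Union>\<C>' = \<Union>?B"
    by (intro exI[of _ "insert S (hit T ` \<V>)"]) simp
qed

section \<open>Convex hulls\<close>

text \<open>For a preorder on a set containing \<open>A\<close>, this is the least order-convex
  superset of \<open>A\<close>.\<close>

definition order_hull :: "'p rel \<Rightarrow> 'p set \<Rightarrow> 'p set" where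
  "order_hull r A = r `` A \<inter> r\<inverse> `` A"

lemma subset_order_hull:
  assumes "refl_on S r" "A \<subseteq> S"
  shows "A \<subseteq> order_hull r A"
  using assms by (auto simp: order_hull_def refl_on_def)

lemma order_convex_order_hull: "trans r \<Longrightarrow> order_convex r (order_hull r A)"
  unfolding order_convex_def order_hull_def trans_def by blast

lemma order_hull_eq_self:
  assumes "refl_on S r" "A \<subseteq> S" "order_convex r A"
  shows "order_hull r A = A"
  using subset_order_hull[OF assms(1,2)] assms(3)
  unfolding order_hull_def order_convex_def by blast

text \<open>Each half of the hull supplies one inclusion of the Egli-Milner relation; the other two
  follow from \<open>A\<close> being contained in its hull.\<close>

lemma order_equiv_order_hull:
  assumes "refl_on S r" "A \<subseteq> S" "A \<in> \<A>" "order_hull r A \<in> \<A>"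
  shows "(order_hull r A, A) \<in> order_equiv (egli_milner r \<A>)"
  using subset_order_hull[OF assms(1,2)] assms(3,4)
  unfolding order_equiv_def egli_milner_def order_hull_def by blast

text \<open>The two relations together place each point of \<open>A\<close> between two points of
  \<open>B\<close>, hence in \<open>B\<close> by convexity; the converse is symmetric.\<close>

lemma order_convex_egli_milner_antisym:
  assumes "(A, B) \<in> egli_milner r \<A>" "(B, A) \<in> egli_milner r \<A>"
    and "order_convex r A" "order_convex r B"
  shows "A = B"
  using assms unfolding egli_milner_def order_convex_def by blast

text \<open>A hull point in \<open>U\<close> lies below some point of \<open>A\<close>, which is
  again in the upset \<open>U\<close>. The next lemma is the dual.\<close>

lemma order_hull_Int_upset:
  assumes "refl_on S r" "A \<subseteq> S" "upset r U"
  shows "order_hull r A \<inter> U = {} \<longleftrightarrow> A \<inter> U = {}"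
  using subset_order_hull[OF assms(1,2)] assms(3)
  unfolding upset_def order_hull_def by blast

lemma order_hull_Int_downset:
  assumes "refl_on S r" "A \<subseteq> S" "upset (r\<inverse>) U"
  shows "order_hull r A \<inter> U = {} \<longleftrightarrow> A \<inter> U = {}"
  using subset_order_hull[OF assms(1,2)] assms(3)
  unfolding upset_def order_hull_def by blast

text \<open>If \<open>C\<close> is below \<open>D\<close>, a point of \<open>C\<close> in
  \<open>U\<close> has a point of \<open>D\<close> above it. Dually, in the next lemma, a point of
  \<open>D\<close> in the downset \<open>K\<close> would have a point of \<open>C\<close> below
  it.\<close>

lemma upset_egli_milner_hit:
  "upset r U \<Longrightarrow> upset (egli_milner r \<A>) {C \<in> \<A>. C \<inter> U \<noteq> {}}"
  unfolding upset_def egli_milner_def by blast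

lemma upset_egli_milner_miss:
  "upset (r\<inverse>) K \<Longrightarrow> upset (egli_milner r \<A>) {C \<in> \<A>. C \<inter> K = {}}"
  unfolding upset_def egli_milner_def by blast

section \<open>The order on convex sets and on equivalence classes\<close>

lemma partial_order_on_convex_closed_sets:
  assumes "partial_order_on (topspace T) r"
  shows "partial_order_on (convex_closed_sets T r) (egli_milner r (convex_closed_sets T r))"
proof -
  let ?C = "convex_closed_sets T r"
  have eq: "egli_milner r ?C = egli_milner r (closed_sets T) \<inter> ?C \<times> ?C"
    by (auto simp: egli_milner_def convex_closed_sets_def)
  have sub: "?C \<subseteq> closed_sets T"
    by (auto simp: convex_closed_sets_def)
  have "preorder_on ?C (egli_milner r ?C)"
    using preorder_on_egli_milner[OF assms] sub
    unfolding eq preorder_on_def refl_on_def trans_def by blast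
  moreover have "antisym (egli_milner r ?C)"
  proof (rule antisymI)
    fix A B assume AB: "(A, B) \<in> egli_milner r ?C" "(B, A) \<in> egli_milner r ?C"
    then have "order_convex r A" "order_convex r B"
      by (auto simp: egli_milner_def convex_closed_sets_def)
    with AB show "A = B"
      by (rule order_convex_egli_milner_antisym)
  qed
  ultimately show ?thesis
    by (simp add: partial_order_on_def)
qed

text \<open>The quotient order asks for some related representatives; transitivity carries the
  relation over to any others.\<close>

lemma quotient_order_class_iff:
  assumes "preorder_on A q" "x \<in> A" "y \<in> A"
  shows "(order_equiv q `` {x}, order_equiv q `` {y}) \<in> quotient_order A q \<longleftrightarrow> (x, y) \<in> q"
proof -
  have tr: "trans q" and "(x, x) \<in> q" "(y, y) \<in> q"
    using assms by (auto simp: preorder_on_def refl_on_def)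
  then have self: "x \<in> order_equiv q `` {x}" "y \<in> order_equiv q `` {y}"
    by (auto simp: order_equiv_def)
  have "(x, y) \<in> q" if "(x, x') \<in> order_equiv q" "(y, y') \<in> order_equiv q" "(x', y') \<in> q" for x' y'
    using that tr unfolding order_equiv_def trans_def by blast
  with self assms(2,3) show ?thesis
    unfolding quotient_order_def by (blast intro: quotientI)
qed

section \<open>The Priestley space of a lattice\<close>

lemma partial_order_on_priestley_order:
  "partial_order_on (topspace priestley_topology) priestley_order"
  by (auto simp: partial_order_on_def preorder_on_def refl_on_def trans_def antisym_def
      priestley_order_def)

lemma refl_on_priestley_order: "refl_on {x. prime_filter x} priestley_order"
  and trans_priestley_order: "trans priestley_order"
  using partial_order_on_priestley_order by (auto simp: partial_order_on_def preorder_on_def)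

lemma upset_pos_set: "upset priestley_order (pos_set a)"
  by (auto simp: upset_def pos_set_def priestley_order_def)

lemma upset_converse_neg_set: "upset (priestley_order\<inverse>) (neg_set a)"
  by (auto simp: upset_def neg_set_def priestley_order_def)

text \<open>Prime filters form a closed subset of the Cantor cube \<open>'a \<Rightarrow> bool\<close>, so
  compactness needs no prime filter theorem.\<close>

lemma compact_space_priestley_topology:
  "compact_space (priestley_topology :: 'a::{distrib_lattice,bounded_lattice} set topology)"
proof -
  let ?P = "{f :: 'a \<Rightarrow> bool. prime_filter {a. f a}}"
  have op: "open {f :: 'a \<Rightarrow> bool. f a}" and cl: "closed {f :: 'a \<Rightarrow> bool. f a}" for a
  proof -
    have eq: "{f :: 'a \<Rightarrow> bool. f a} = (\<lambda>f. f a) -` {True}" by auto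
    show "open {f :: 'a \<Rightarrow> bool. f a}"
      unfolding eq by (rule open_vimage[OF open_discrete continuous_on_product_coordinates])
    show "closed {f :: 'a \<Rightarrow> bool. f a}"
      unfolding eq by (rule closed_vimage[OF closed_singleton continuous_on_product_coordinates])
  qed
  \<comment> \<open>For fixed \<open>a\<close> and \<open>b\<close> each clause is a Boolean
    combination of clopen coordinate conditions; the quantifiers become intersections of closed
    sets.\<close>
  have "closed ?P"
    unfolding prime_filter_def mem_Collect_eq
    by (intro closed_Collect_conj closed_Collect_all closed_Collect_imp closed_Collect_disj
        open_Collect_conj closed_Collect_neg open_Collect_const op cl)
  moreover have "compact (UNIV :: ('a \<Rightarrow> bool) set)"
  proof -
    have "compact_space (product_topology (\<lambda>_::'a. euclidean :: bool topology) UNIV)"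
      unfolding compact_space_product_topology by (simp add: compact_space_def finite_imp_compact)
    then show ?thesis
      by (simp only: euclidean_product_topology compact_space_def topspace_euclidean
          compactin_euclidean_iff)
  qed
  ultimately have P: "compactin euclidean ?P"
    using compact_Int_closed[of UNIV ?P] by (simp only: compactin_euclidean_iff Int_UNIV_left)
  have "continuous_map (top_of_set ?P) priestley_topology (\<lambda>f. {a. f a})"
    unfolding priestley_topology_def
  proof (rule continuous_on_generated_topo)
    fix U :: "'a set set" assume "U \<in> range pos_set \<union> range neg_set"
    then obtain a where "U = pos_set a \<or> U = neg_set a" by auto
    then have "(\<lambda>f. {a. f a}) -` U \<inter> ?P = ?P \<inter> {f. f a} \<or>
        (\<lambda>f. {a. f a}) -` U \<inter> ?P = ?P \<inter> - {f. f a}"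
      by (auto simp: pos_set_def neg_set_def)
    then show "openin (top_of_set ?P) ((\<lambda>f. {a. f a}) -` U \<inter> topspace (top_of_set ?P))"
      using openin_open_Int[OF op, of ?P a] openin_open_Int[OF open_Compl[OF cl], of ?P a]
      unfolding topspace_euclidean_subtopology by (elim disjE) (simp_all only:)
  qed (auto simp: pos_set_def neg_set_def)
  moreover have "compactin (top_of_set ?P) ?P"
    using P by (simp add: compactin_subtopology)
  ultimately have "compactin priestley_topology ((\<lambda>f. {a. f a}) ` ?P)"
    by (rule image_compactin[rotated])
  moreover have "(\<lambda>f. {a. f a}) ` ?P = {x. prime_filter x}"
  proof -
    have "x \<in> (\<lambda>f. {a. f a}) ` ?P" if "prime_filter x" for x
      using that by (intro image_eqI[of _ _ "\<lambda>a. a \<in> x"]) auto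
    then show ?thesis by auto
  qed
  ultimately show ?thesis
    by (simp add: compact_space_def)
qed

section \<open>Basic clopen sets and separation from closed sets\<close>

lemma openin_pos_set: "openin priestley_topology (pos_set a)"
  and openin_neg_set: "openin priestley_topology (neg_set a)"
  by (auto simp: priestley_topology_def intro!: topology_generated_by_Basis)

lemma pos_set_eq_Diff: "pos_set a = {x. prime_filter x} - neg_set a"
  and neg_set_eq_Diff: "neg_set a = {x. prime_filter x} - pos_set a"
  by (auto simp: pos_set_def neg_set_def)

text \<open>Compactness of \<open>pos_set a\<close>, and below of \<open>neg_set a\<close>, makes
  their miss sets open in the hit-or-miss topology.\<close>

lemma compactin_pos_set: "compactin priestley_topology (pos_set a)"
  unfolding pos_set_eq_Diff topspace_priestley_topology[symmetric]
  by (intro closedin_compact_space compact_space_priestley_topology closedin_diff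
      closedin_topspace openin_neg_set)

lemma compactin_neg_set: "compactin priestley_topology (neg_set a)"
  unfolding neg_set_eq_Diff topspace_priestley_topology[symmetric]
  by (intro closedin_compact_space compact_space_priestley_topology closedin_diff
      closedin_topspace openin_pos_set)

text \<open>A finite subcover is absorbed into a single member by directedness. The case
  \<open>F = {}\<close> forces \<open>A\<close> to be nonempty, which the conclusion demands even
  when \<open>K\<close> is empty.\<close>

lemma compactin_imp_subset_basic:
  assumes K: "compactin T K"
    and op: "\<And>a. openin T (P a)"
    and cov: "\<And>y. y \<in> K \<Longrightarrow> \<exists>a\<in>A. y \<in> P a"
    and directed: "\<And>F. \<lbrakk>finite F; F \<subseteq> A\<rbrakk> \<Longrightarrow> \<exists>b\<in>A. (\<Union>a\<in>F. P a) \<subseteq> P b"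
  shows "\<exists>b\<in>A. K \<subseteq> P b"
proof -
  have "K \<subseteq> \<Union>(P ` A)" using cov by blast
  then obtain \<V> where "finite \<V>" "\<V> \<subseteq> P ` A" "K \<subseteq> \<Union>\<V>"
    using compactinD[OF K, of "P ` A"] op by auto
  then obtain F where "finite F" "F \<subseteq> A" "K \<subseteq> (\<Union>a\<in>F. P a)"
    by (metis finite_subset_image)
  then show ?thesis using directed by (meson order_trans)
qed

text \<open>Each \<open>y\<close> in \<open>K\<close> is not contained in \<open>x\<close>, so it
  has an element outside \<open>x\<close>. Since \<open>x\<close> is prime, its complement is closed
  under joins, which makes the cover of \<open>K\<close> directed; \<open>bot\<close> serves the
  empty subfamily.\<close>

lemma separate_from_upclosure:
  assumes K: "closedin priestley_topology K" and x: "prime_filter x"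
    and nin: "x \<notin> priestley_order `` K"
  shows "\<exists>a. K \<subseteq> pos_set a \<and> x \<in> neg_set a"
proof -
  have "\<exists>b\<in>- x. K \<subseteq> pos_set b"
  proof (rule compactin_imp_subset_basic)
    show "compactin priestley_topology K"
      by (rule closedin_compact_space[OF compact_space_priestley_topology K])
    show "\<exists>a\<in>- x. y \<in> pos_set a" if "y \<in> K" for y
      using that nin x closedin_subset[OF K] by (auto simp: priestley_order_def pos_set_def)
    show "\<exists>b\<in>- x. (\<Union>a\<in>F. pos_set a) \<subseteq> pos_set b" if "finite F" "F \<subseteq> - x" for F
      using that
    proof (induction F)
      case empty
      then show ?case using x by (auto simp: prime_filter_def)
    next
      case (insert a F)
      then obtain b where "b \<notin> x" "(\<Union>a\<in>F. pos_set a) \<subseteq> pos_set b" by auto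
      moreover have "pos_set a \<union> pos_set b \<subseteq> pos_set (sup a b)"
        by (auto simp: pos_set_def prime_filter_def intro: sup_ge1 sup_ge2)
      moreover have "sup a b \<notin> x"
        using x insert.prems \<open>b \<notin> x\<close> by (auto simp: prime_filter_def)
      ultimately show ?case by (intro bexI[of _ "sup a b"]) auto
    qed
  qed (rule openin_pos_set)
  with x show ?thesis by (auto simp: neg_set_def)
qed

text \<open>Dually, \<open>x\<close> is not contained in any \<open>y\<close> in \<open>K\<close>;
  the cover is indexed by \<open>x\<close>, which is closed under meets and contains
  \<open>top\<close>.\<close>

lemma separate_from_downclosure:
  assumes K: "closedin priestley_topology K" and x: "prime_filter x"
    and nin: "x \<notin> priestley_order\<inverse> `` K"
  shows "\<exists>a. K \<subseteq> neg_set a \<and> x \<in> pos_set a"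
proof -
  have "\<exists>b\<in>x. K \<subseteq> neg_set b"
  proof (rule compactin_imp_subset_basic)
    show "compactin priestley_topology K"
      by (rule closedin_compact_space[OF compact_space_priestley_topology K])
    show "\<exists>a\<in>x. y \<in> neg_set a" if "y \<in> K" for y
      using that nin x closedin_subset[OF K] by (auto simp: priestley_order_def neg_set_def)
    show "\<exists>b\<in>x. (\<Union>a\<in>F. neg_set a) \<subseteq> neg_set b" if "finite F" "F \<subseteq> x" for F
      using that
    proof (induction F)
      case empty
      then show ?case using x by (auto simp: prime_filter_def)
    next
      case (insert a F)
      then obtain b where "b \<in> x" "(\<Union>a\<in>F. neg_set a) \<subseteq> neg_set b" by auto
      moreover have "neg_set a \<union> neg_set b \<subseteq> neg_set (inf a b)"
        by (auto simp: neg_set_def prime_filter_def intro: inf_le1 inf_le2)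
      moreover have "inf a b \<in> x"
        using x insert.prems \<open>b \<in> x\<close> by (auto simp: prime_filter_def)
      ultimately show ?case by (intro bexI[of _ "inf a b"]) auto
    qed
  qed (rule openin_neg_set)
  with x show ?thesis by (auto simp: pos_set_def)
qed

text \<open>A point outside the hull misses the up-closure or the down-closure of \<open>K\<close>.
  Separation then encloses that closure in a basic clopen set whose complement is a neighbourhood of
  the point.\<close>

lemma closedin_order_hull:
  assumes K: "closedin priestley_topology K"
  shows "closedin priestley_topology (order_hull priestley_order K)"
proof -
  have "openin priestley_topology ({x. prime_filter x} - order_hull priestley_order K)"
  proof (subst openin_subopen, intro ballI)
    fix x assume x: "x \<in> {x. prime_filter x} - order_hull priestley_order K"
    then consider "x \<notin> priestley_order `` K" | "x \<notin> priestley_order\<inverse> `` K"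
      by (auto simp: order_hull_def)
    then show "\<exists>U. openin priestley_topology U \<and> x \<in> U \<and>
        U \<subseteq> {x. prime_filter x} - order_hull priestley_order K"
    proof cases
      case 1
      then obtain a where "K \<subseteq> pos_set a" "x \<in> neg_set a"
        using separate_from_upclosure[OF K, of x] x by blast
      then show ?thesis
        by (intro exI[of _ "neg_set a"] conjI openin_neg_set)
          (auto simp: neg_set_def pos_set_def order_hull_def priestley_order_def)
    next
      case 2
      then obtain a where "K \<subseteq> neg_set a" "x \<in> pos_set a"
        using separate_from_downclosure[OF K, of x] x by blast
      then show ?thesis
        by (intro exI[of _ "pos_set a"] conjI openin_pos_set)
          (auto simp: neg_set_def pos_set_def order_hull_def priestley_order_def)
    qed
  qed
  moreover have "order_hull priestley_order K \<subseteq> {x. prime_filter x}"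
    by (auto simp: order_hull_def priestley_order_def)
  ultimately show ?thesis
    by (simp add: closedin_def)
qed

lemma order_hull_in_convex_closed_sets:
  "K \<in> closed_sets priestley_topology \<Longrightarrow>
    order_hull priestley_order K \<in> convex_closed_sets priestley_topology priestley_order"
  by (simp add: convex_closed_sets_def closed_sets_def closedin_order_hull
      order_convex_order_hull trans_priestley_order)

section \<open>The weak hit-or-miss topology\<close>

lemma continuous_map_order_hull:
  "continuous_map (hit_or_miss_topology priestley_topology)
     (weak_hit_or_miss_topology :: 'a::{distrib_lattice,bounded_lattice} set set topology)
     (order_hull priestley_order)"
  unfolding weak_hit_or_miss_topology_def
proof (rule continuous_on_generated_topo)
  let ?T = "priestley_topology :: 'a set topology"
  let ?h = "order_hull (priestley_order :: 'a set rel)"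
  let ?C = "convex_closed_sets ?T priestley_order"
  let ?S = "{S \<inter> ?C | S a. S \<in> {miss ?T (pos_set a), miss ?T (neg_set a),
      hit ?T (pos_set a), hit ?T (neg_set a)}}"
  have "\<Union>?S = ?C"
    using topspace_weak_hit_or_miss_topology[where ?'a = 'a]
    unfolding weak_hit_or_miss_topology_def topology_generated_by_topspace .
  then show "?h ` topspace (hit_or_miss_topology ?T) \<subseteq> \<Union>?S"
    using order_hull_in_convex_closed_sets
    unfolding topspace_hit_or_miss_topology by (simp only: image_subset_iff) blast
  fix V assume "V \<in> ?S"
  then obtain a S where V: "V = S \<inter> ?C"
    and S: "S \<in> {miss ?T (pos_set a), miss ?T (neg_set a), hit ?T (pos_set a), hit ?T (neg_set a)}"
    by blast
  have hull: "?h K \<in> ?C" "?h K \<in> closed_sets ?T"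
      "?h K \<inter> pos_set a = {} \<longleftrightarrow> K \<inter> pos_set a = {}"
      "?h K \<inter> neg_set a = {} \<longleftrightarrow> K \<inter> neg_set a = {}"
    if "K \<in> closed_sets ?T" for K
  proof -
    have K: "K \<subseteq> {x. prime_filter x}"
      using that closedin_subset[of ?T K] by (simp add: closed_sets_def)
    show "?h K \<inter> pos_set a = {} \<longleftrightarrow> K \<inter> pos_set a = {}"
      "?h K \<inter> neg_set a = {} \<longleftrightarrow> K \<inter> neg_set a = {}"
      by (rule order_hull_Int_upset[OF refl_on_priestley_order K upset_pos_set]
          order_hull_Int_downset[OF refl_on_priestley_order K upset_converse_neg_set])+
    show "?h K \<in> ?C"
      using that by (rule order_hull_in_convex_closed_sets)
    then show "?h K \<in> closed_sets ?T"
      by (simp add: convex_closed_sets_def)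
  qed
  \<comment> \<open>The preimage of the restriction of \<open>S\<close> to convex sets is
    \<open>S\<close> itself, since a set and its hull meet the same basic sets.\<close>
  have "K \<in> ?h -` V \<inter> closed_sets ?T \<longleftrightarrow> K \<in> S" for K
  proof (cases "K \<in> closed_sets ?T")
    case True
    then show ?thesis
      using S hull[OF True] unfolding V hit_def miss_def by (elim insertE emptyE) simp_all
  next
    case False
    then show ?thesis
      using S unfolding hit_def miss_def by (elim insertE emptyE) simp_all
  qed
  then have "?h -` V \<inter> closed_sets ?T = S"
    by (rule set_eqI)
  moreover have "openin (hit_or_miss_topology ?T) S"
    unfolding hit_or_miss_topology_def
    using S openin_pos_set[of a] openin_neg_set[of a] compactin_pos_set[of a] compactin_neg_set[of a]
    by (intro topology_generated_by_Basis) blast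
  ultimately show "openin (hit_or_miss_topology ?T) (?h -` V \<inter> topspace (hit_or_miss_topology ?T))"
    by simp
qed

text \<open>Every convex closed set is its own hull, so the hull map is a retraction onto the convex
  closed sets.\<close>

lemma order_hull_image_closed_sets:
  "order_hull priestley_order ` closed_sets priestley_topology =
     convex_closed_sets priestley_topology priestley_order"
proof -
  have "order_hull priestley_order C = C"
    if "C \<in> convex_closed_sets priestley_topology priestley_order" for C
  proof (rule order_hull_eq_self[OF refl_on_priestley_order])
    show "C \<subseteq> {x. prime_filter x}" "order_convex priestley_order C"
      using that closedin_subset[of priestley_topology C]
      by (simp_all add: convex_closed_sets_def closed_sets_def)
  qed
  then have "C \<in> order_hull priestley_order ` closed_sets priestley_topology"
    if "C \<in> convex_closed_sets priestley_topology priestley_order" for C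
    using that by (intro image_eqI[of _ _ C]) (auto simp: convex_closed_sets_def)
  with order_hull_in_convex_closed_sets show ?thesis by blast
qed

lemma compact_space_weak_hit_or_miss_topology: "compact_space weak_hit_or_miss_topology"
  using image_compactin[OF _ continuous_map_order_hull, of "closed_sets priestley_topology"]
    compact_space_hit_or_miss_topology[of priestley_topology]
  by (simp add: compact_space_def order_hull_image_closed_sets)

section \<open>Priestley separation for convex closed sets\<close>

lemma openin_weak_hit_or_miss_topology:
  assumes "S \<in> {miss priestley_topology (pos_set a), miss priestley_topology (neg_set a),
    hit priestley_topology (pos_set a), hit priestley_topology (neg_set a)}"
  shows "openin weak_hit_or_miss_topology
    (S \<inter> convex_closed_sets priestley_topology priestley_order)"
  unfolding weak_hit_or_miss_topology_def
  using assms by (intro topology_generated_by_Basis) blast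

text \<open>Hit and miss sets of the same set are complementary, so every subbasic set is
  clopen.\<close>

lemma closedin_weak_hit_or_miss_topology:
  assumes "S \<in> {miss priestley_topology (pos_set a), miss priestley_topology (neg_set a),
    hit priestley_topology (pos_set a), hit priestley_topology (neg_set a)}"
  shows "closedin weak_hit_or_miss_topology
    (S \<inter> convex_closed_sets priestley_topology priestley_order)"
proof -
  let ?C = "convex_closed_sets priestley_topology priestley_order"
  have "?C - miss priestley_topology K \<inter> ?C = hit priestley_topology K \<inter> ?C"
    "?C - hit priestley_topology K \<inter> ?C = miss priestley_topology K \<inter> ?C" for K :: "'a set set"
    by (auto simp: hit_def miss_def convex_closed_sets_def)
  with assms show ?thesis
    unfolding closedin_def by (auto intro: openin_weak_hit_or_miss_topology)
qed

lemma Priestley_space_weak_hit_or_miss_topology: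
  "Priestley_space weak_hit_or_miss_topology
     (egli_milner priestley_order (convex_closed_sets priestley_topology priestley_order ::
        'a::{distrib_lattice,bounded_lattice} set set set))"
proof -
  let ?T = "priestley_topology :: 'a set topology"
  let ?r = "priestley_order :: 'a set rel"
  let ?C = "convex_closed_sets ?T ?r"
  have "\<exists>U. openin weak_hit_or_miss_topology U \<and> closedin weak_hit_or_miss_topology U \<and>
      upset (egli_milner ?r ?C) U \<and> A \<in> U \<and> B \<notin> U"
    if A: "A \<in> ?C" and B: "B \<in> ?C" and AB: "(A, B) \<notin> egli_milner ?r ?C" for A B
  proof -
    have cl: "closedin ?T A" "closedin ?T B" "A \<in> closed_sets ?T" "B \<in> closed_sets ?T"
      using A B by (auto simp: convex_closed_sets_def closed_sets_def)
    have pf: "A \<subseteq> {x. prime_filter x}" "B \<subseteq> {x. prime_filter x}"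
      using cl(1,2) closedin_subset by fastforce+
    \<comment> \<open>Failure of the Egli-Milner relation has two possible witnesses: the first is
      separated by a hit set of a clopen upset, the second by a miss set of a clopen
      downset.\<close>
    consider x where "x \<in> A" "x \<notin> ?r\<inverse> `` B" | x where "x \<in> B" "x \<notin> ?r `` A"
      using A B AB unfolding egli_milner_def by blast
    then show ?thesis
    proof cases
      case 1
      then obtain a where a: "B \<subseteq> neg_set a" "x \<in> pos_set a"
        using separate_from_downclosure[OF cl(2)] pf by blast
      let ?U = "hit ?T (pos_set a) \<inter> ?C"
      have "?U = {D \<in> ?C. D \<inter> pos_set a \<noteq> {}}"
        unfolding hit_def convex_closed_sets_def by blast
      then have "upset (egli_milner ?r ?C) ?U"
        using upset_egli_milner_hit[OF upset_pos_set] by simp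
      moreover have "A \<in> ?U" "B \<notin> ?U"
        using a 1 A cl by (auto simp: hit_def pos_set_def neg_set_def)
      ultimately show ?thesis
        by (intro exI[of _ ?U] conjI openin_weak_hit_or_miss_topology[of _ a]
            closedin_weak_hit_or_miss_topology[of _ a]) simp_all
    next
      case 2
      then obtain a where a: "A \<subseteq> pos_set a" "x \<in> neg_set a"
        using separate_from_upclosure[OF cl(1)] pf by blast
      let ?U = "miss ?T (neg_set a) \<inter> ?C"
      have "?U = {D \<in> ?C. D \<inter> neg_set a = {}}"
        unfolding miss_def convex_closed_sets_def by blast
      then have "upset (egli_milner ?r ?C) ?U"
        using upset_egli_milner_miss[OF upset_converse_neg_set] by simp
      moreover have "A \<in> ?U" "B \<notin> ?U"
        using a 2 A cl by (auto simp: miss_def pos_set_def neg_set_def)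
      ultimately show ?thesis
        by (intro exI[of _ ?U] conjI openin_weak_hit_or_miss_topology[of _ a]
            closedin_weak_hit_or_miss_topology[of _ a]) simp_all
    qed
  qed
  then show ?thesis
    using partial_order_on_convex_closed_sets[OF partial_order_on_priestley_order]
    by (simp add: Priestley_space_def compact_space_weak_hit_or_miss_topology)
qed

text \<open>By antisymmetry one of two distinct points is not below the other; the separating clopen
  upset and its complement are the required neighbourhoods.\<close>

lemma Hausdorff_space_Priestley_space:
  assumes "Priestley_space T r"
  shows "Hausdorff_space T"
  unfolding Hausdorff_space_def
proof (intro allI impI)
  fix x y assume xy: "x \<in> topspace T \<and> y \<in> topspace T \<and> x \<noteq> y"
  have "antisym r"
    using assms by (auto simp: Priestley_space_def partial_order_on_def)
  then have "(x, y) \<notin> r \<or> (y, x) \<notin> r"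
    using xy by (auto dest: antisymD)
  then obtain U where "openin T U" "closedin T U" "x \<in> U \<and> y \<notin> U \<or> y \<in> U \<and> x \<notin> U"
    using assms xy unfolding Priestley_space_def by meson
  moreover have "disjnt U (topspace T - U)"
    by (simp add: disjnt_def)
  ultimately show "\<exists>U V. openin T U \<and> openin T V \<and> x \<in> U \<and> y \<in> V \<and> disjnt U V"
    using xy by (metis Diff_iff closedin_def disjnt_sym)
qed

section \<open>The order-homeomorphism onto the quotient\<close>

theorem theorem4p8:
  fixes T :: "'a::{distrib_lattice,bounded_lattice} set topology"
    and r :: "'a set rel"
  defines "T \<equiv> priestley_topology"
    and "r \<equiv> priestley_order"
  defines "\<C> \<equiv> convex_closed_sets T r"
    and "\<F> \<equiv> closed_sets T"
  shows "order_homeomorphic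
           weak_hit_or_miss_topology (egli_milner r \<C>)
           (quotient_topology (hit_or_miss_topology T) (order_equiv (egli_milner r \<F>)))
           (quotient_order \<F> (egli_milner r \<F>))
       \<and> Priestley_space weak_hit_or_miss_topology (egli_milner r \<C>)"
proof
  show P: "Priestley_space weak_hit_or_miss_topology (egli_milner r \<C>)"
    unfolding \<C>_def T_def r_def by (rule Priestley_space_weak_hit_or_miss_topology)
  let ?W = "weak_hit_or_miss_topology :: 'a set set topology"
  let ?q = "egli_milner r \<F>"
  let ?e = "order_equiv ?q"
  let ?Q = "quotient_topology (hit_or_miss_topology T) ?e"
  let ?f = "\<lambda>C. ?e `` {C}"
  have pre: "preorder_on \<F> ?q"
    unfolding \<F>_def T_def r_def
    by (rule preorder_on_egli_milner[OF partial_order_on_priestley_order])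
  have sub: "\<C> \<subseteq> \<F>" and W: "topspace ?W = \<C>"
    by (auto simp: \<C>_def \<F>_def convex_closed_sets_def T_def r_def)
  have "?f (order_hull r K) = ?f K" if K: "K \<in> \<F>" for K
  proof (rule equiv_class_eq[OF equiv_order_equiv[OF pre]])
    have "K \<subseteq> {x. prime_filter x}"
      using K closedin_subset[of T K] by (simp add: \<F>_def closed_sets_def T_def)
    moreover have "order_hull r K \<in> \<F>"
      using K sub order_hull_in_convex_closed_sets by (auto simp: \<C>_def \<F>_def T_def r_def)
    ultimately show "(order_hull r K, K) \<in> ?e"
      using K order_equiv_order_hull refl_on_priestley_order unfolding r_def by blast
  qed
  \<comment> \<open>A set and its hull have the same class, so the canonical quotient map factors as
    \<open>?f\<close> after the hull map.\<close>
  then have q: "quotient_map (hit_or_miss_topology T) ?Q (?f \<circ> order_hull r)"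
    using quotient_map_quotient_topology[of "hit_or_miss_topology T" ?e]
    by (auto elim!: quotient_map_eq simp: \<F>_def)
  have h: "continuous_map (hit_or_miss_topology T) ?W (order_hull r)"
    unfolding T_def r_def by (rule continuous_map_order_hull)
  \<comment> \<open>A continuous surjection from a compact space onto a Hausdorff space is a
    quotient map.\<close>
  then have "quotient_map (hit_or_miss_topology T) ?W (order_hull r)"
    using compact_space_hit_or_miss_topology Hausdorff_space_Priestley_space[OF P]
    by (intro continuous_imp_quotient_map)
      (simp_all add: T_def r_def order_hull_image_closed_sets)
  \<comment> \<open>As the hull map is a quotient map, \<open>?f\<close> is one exactly when the
    composite is.\<close>
  then have "quotient_map ?W ?Q ?f"
    using q by (simp add: quotient_map_compose_eq)
  \<comment> \<open>Equivalent convex sets are equal, and an injective quotient map is a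
    homeomorphism.\<close>
  moreover have "inj_on ?f (topspace ?W)"
  proof (rule inj_onI)
    fix C D assume CD: "C \<in> topspace ?W" "D \<in> topspace ?W" "?f C = ?f D"
    then have "(C, D) \<in> ?e"
      using sub W eq_equiv_class_iff[OF equiv_order_equiv[OF pre]] by blast
    then show "C = D"
      using CD W order_convex_egli_milner_antisym
      by (fastforce simp: order_equiv_def \<C>_def convex_closed_sets_def)
  qed
  ultimately have "homeomorphic_map ?W ?Q ?f"
    by (simp add: homeomorphic_map_def)
  moreover have "(C, D) \<in> egli_milner r \<C> \<longleftrightarrow> (?f C, ?f D) \<in> quotient_order \<F> ?q"
    if "C \<in> \<C>" "D \<in> \<C>" for C D
  proof -
    have "(C, D) \<in> egli_milner r \<C> \<longleftrightarrow> (C, D) \<in> ?q"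
      using that sub by (auto simp: egli_milner_def)
    also have "\<dots> \<longleftrightarrow> (?f C, ?f D) \<in> quotient_order \<F> ?q"
      using that sub by (intro quotient_order_class_iff[OF pre, symmetric]) auto
    finally show ?thesis .
  qed
  ultimately show "order_homeomorphic ?W (egli_milner r \<C>) ?Q (quotient_order \<F> ?q)"
    unfolding order_homeomorphic_def W by blast
qed

end
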